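(* Let $G$ be a braced ribbon-cutting graph such that every two distinct vertices are separated by a ribbon of $G$. Then the bracing graph of $G$ is connected if and only if $G$ does not have a cartesian NAC-coloring.
   Context: For a graph $H$, two edges are related if they are opposite edges of a 4-cycle subgraph of $H$; a ribbon of $H$ is an equivalence class of the reflexive–transitive closure of this relation. A ribbon-cutting graph is a connected graph in which every ribbon is an edge cut (its removal disconnects the graph). A braced ribbon-cutting graph is a graph $G=(V_G,E_c\cup E_d)$, where $E_c,E_d$ are non-empty disjoint sets, $(V_G,E_c)$ is ribbon-cutting, and every edge of $E_d$ (a brace) is a diagonal $u_1u_3$ of some 4-cycle $(u_1,u_2,u_3,u_4)$ of $(V_G,E_c)$. The ribbons of $G$ are the sets $r\cup\{u_1u_3\in E_d: \exists\text{ 4-cycle }(u_1,u_2,u_3,u_4)\text{ of }(V_G,E_c)\text{ with }u_1u_2,u_3u_4\in r\}$ for ribbons $r$ of $(V_G,E_c)$. A ribbon $r$ of $G$ separates $x,y$ if they lie in different connected components of $(V_G,(E_c\cup E_d)\setminus r)$. The ribbon graph $\Gamma$ of $G$ has the ribbons of $G$ as vertices, two ribbons $r_1,r_2$ being adjacent iff there is a 4-cycle $(u_1,u_2,u_3,u_4)$ in $G$ with $u_1u_2,u_3u_4\in r_1$ and $u_1u_4,u_2u_3\in r_2$. The bracing graph is the subgraph $(V_\Gamma,E_b)$ with $E_b=\{r_1r_2\in E_\Gamma: r_1\cap r_2\text{ is non-empty (and hence consists of braces)}\}$. A NAC-coloring of $G$ is a surjective map $\delta:E_G\to\{\text{red},\text{blue}\}$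 such that every cycle is monochromatic or contains at least two edges of each color; it is cartesian if no two distinct vertices are connected by both a red path and a blue path. *)

theory Defs
  imports Main
begin

text \<open>
  A graph is given by its vertex set and its edge set, an edge being a two-element set of vertices.
  Graphs are simple and undirected; they may be infinite.
\<close>

definition simple_graph :: "'a set \<Rightarrow> 'a set set \<Rightarrow> bool" where
  "simple_graph V E \<longleftrightarrow> (\<forall>e\<in>E. \<exists>u\<in>V. \<exists>v\<in>V. u \<noteq> v \<and> e = {u, v})"

definition walk_edges :: "'a list \<Rightarrow> 'a set set" where
  "walk_edges p = {{p ! i, p ! Suc i} | i. Suc i < length p}"

definition is_path :: "'a set \<Rightarrow> 'a set set \<Rightarrow> 'a \<Rightarrow> 'a list \<Rightarrow> 'a \<Rightarrow> bool" where
  "is_path V E x p y \<longleftrightarrow>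
     p \<noteq> [] \<and> distinct p \<and> set p \<subseteq> V \<and> walk_edges p \<subseteq> E \<and> hd p = x \<and> last p = y"

definition joined :: "'a set \<Rightarrow> 'a set set \<Rightarrow> 'a \<Rightarrow> 'a \<Rightarrow> bool" where
  "joined V E x y \<longleftrightarrow> (\<exists>p. is_path V E x p y)"

definition connected_graph :: "'a set \<Rightarrow> 'a set set \<Rightarrow> bool" where
  "connected_graph V E \<longleftrightarrow> V \<noteq> {} \<and> (\<forall>x\<in>V. \<forall>y\<in>V. joined V E x y)"

text \<open>A cycle is the list of its vertices, without repetition of the starting vertex.\<close>

definition cycle_edges :: "'a list \<Rightarrow> 'a set set" where
  "cycle_edges c = walk_edges (c @ [hd c])"

definition is_cycle :: "'a set set \<Rightarrow> 'a list \<Rightarrow> bool" where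
  "is_cycle E c \<longleftrightarrow> length c \<ge> 3 \<and> distinct c \<and> cycle_edges c \<subseteq> E"

definition four_cycle :: "'a set set \<Rightarrow> 'a \<Rightarrow> 'a \<Rightarrow> 'a \<Rightarrow> 'a \<Rightarrow> bool" where
  "four_cycle E u1 u2 u3 u4 \<longleftrightarrow> is_cycle E [u1, u2, u3, u4]"

text \<open>The other pair of opposite edges of a 4-cycle is obtained by rotating the cycle.\<close>

definition opposite :: "'a set set \<Rightarrow> 'a set rel" where
  "opposite E = {({u1, u2}, {u3, u4}) | u1 u2 u3 u4. four_cycle E u1 u2 u3 u4}"

definition ribbons :: "'a set set \<Rightarrow> 'a set set set" where
  "ribbons E = E // (opposite E)\<^sup>*"

definition ribbon_cutting :: "'a set \<Rightarrow> 'a set set \<Rightarrow> bool" where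
  "ribbon_cutting V E \<longleftrightarrow>
     simple_graph V E \<and> connected_graph V E \<and>
     (\<forall>r\<in>ribbons E. \<not> connected_graph V (E - r))"

text \<open>
  A braced graph is given by its vertices \<open>V\<close>, its unbraced edges \<open>Ec\<close> and its braces \<open>Ed\<close>.
\<close>

definition braced_ribbon_cutting :: "'a set \<Rightarrow> 'a set set \<Rightarrow> 'a set set \<Rightarrow> bool" where
  "braced_ribbon_cutting V Ec Ed \<longleftrightarrow>
     Ec \<noteq> {} \<and> Ed \<noteq> {} \<and> Ec \<inter> Ed = {} \<and> ribbon_cutting V Ec \<and>
     (\<forall>e\<in>Ed. \<exists>u1 u2 u3 u4. four_cycle Ec u1 u2 u3 u4 \<and> e = {u1, u3})"

definition brace_ribbon :: "'a set set \<Rightarrow> 'a set set \<Rightarrow> 'a set set \<Rightarrow> 'a set set" where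
  "brace_ribbon Ec Ed r =
     r \<union> {{u1, u3} | u1 u3. {u1, u3} \<in> Ed \<and>
            (\<exists>u2 u4. four_cycle Ec u1 u2 u3 u4 \<and> {u1, u2} \<in> r \<and> {u3, u4} \<in> r)}"

definition braced_ribbons :: "'a set set \<Rightarrow> 'a set set \<Rightarrow> 'a set set set" where
  "braced_ribbons Ec Ed = brace_ribbon Ec Ed ` ribbons Ec"

definition separates ::
    "'a set \<Rightarrow> 'a set set \<Rightarrow> 'a set set \<Rightarrow> 'a set set \<Rightarrow> 'a \<Rightarrow> 'a \<Rightarrow> bool" where
  "separates V Ec Ed r x y \<longleftrightarrow> \<not> joined V ((Ec \<union> Ed) - r) x y"

text \<open>
  The ribbon graph is simple, so loops are excluded. Its 4-cycles range over the whole braced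
  graph, braces included.
\<close>

definition ribbon_graph_edges :: "'a set set \<Rightarrow> 'a set set \<Rightarrow> 'a set set set set" where
  "ribbon_graph_edges Ec Ed =
     {{r1, r2} | r1 r2. r1 \<in> braced_ribbons Ec Ed \<and> r2 \<in> braced_ribbons Ec Ed \<and> r1 \<noteq> r2 \<and>
        (\<exists>u1 u2 u3 u4. four_cycle (Ec \<union> Ed) u1 u2 u3 u4 \<and>
           {u1, u2} \<in> r1 \<and> {u3, u4} \<in> r1 \<and> {u1, u4} \<in> r2 \<and> {u2, u3} \<in> r2)}"

text \<open>The bracing graph has vertex set \<open>braced_ribbons Ec Ed\<close> and the following edges.\<close>

definition bracing_edges :: "'a set set \<Rightarrow> 'a set set \<Rightarrow> 'a set set set set" where
  "bracing_edges Ec Ed =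
     {{r1, r2} | r1 r2. {r1, r2} \<in> ribbon_graph_edges Ec Ed \<and> r1 \<inter> r2 \<noteq> {}}"

datatype colour = Red | Blue

definition colour_class :: "'a set set \<Rightarrow> ('a set \<Rightarrow> colour) \<Rightarrow> colour \<Rightarrow> 'a set set" where
  "colour_class E \<delta> c = {e \<in> E. \<delta> e = c}"

text \<open>Only the values of \<open>\<delta>\<close> on \<open>E\<close> matter.\<close>

definition NAC_colouring :: "'a set set \<Rightarrow> ('a set \<Rightarrow> colour) \<Rightarrow> bool" where
  "NAC_colouring E \<delta> \<longleftrightarrow>
     \<delta> ` E = {Red, Blue} \<and>
     (\<forall>c. is_cycle E c \<longrightarrow>
        (\<exists>k. \<forall>e\<in>cycle_edges c. \<delta> e = k) \<or>
        (\<forall>k. card {e \<in> cycle_edges c. \<delta> e = k} \<ge> 2))"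

definition cartesian_NAC_colouring :: "'a set \<Rightarrow> 'a set set \<Rightarrow> ('a set \<Rightarrow> colour) \<Rightarrow> bool" where
  "cartesian_NAC_colouring V E \<delta> \<longleftrightarrow>
     NAC_colouring E \<delta> \<and>
     \<not> (\<exists>x\<in>V. \<exists>y\<in>V. x \<noteq> y \<and>
          joined V (colour_class E \<delta> Red) x y \<and> joined V (colour_class E \<delta> Blue) x y)"

end

theory Submission imports Defs begin

text \<open>
  A ribbon of \<open>G\<close> that separates two vertices meets every path between them. So if each
  component of the bracing graph is coloured with one colour, a separating ribbon is monochromatic,
  and no two vertices are joined in both colours; a cycle with exactly one edge of some
  colour would join the ends of that edge in both colours. Conversely, in a cartesian NAC-colouring
  opposite edges of a 4-cycle have the same colour and triangles are monochromatic, so that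
  each ribbon is monochromatic, and ribbons sharing a brace have the same colour.
\<close>

section \<open>Walks, paths and joined vertices\<close>

definition adj :: "'a set \<Rightarrow> 'a set set \<Rightarrow> 'a rel" where
  "adj V E = {(a, b). a \<in> V \<and> b \<in> V \<and> {a, b} \<in> E}"

lemma walk_edges_nth: "Suc i < length p \<Longrightarrow> {p ! i, p ! Suc i} \<in> walk_edges p"
  by (auto simp: walk_edges_def)

lemma walk_edges_Nil [simp]: "walk_edges [] = {}"
  by (simp add: walk_edges_def)

lemma walk_edges_single [simp]: "walk_edges [x] = {}"
  by (simp add: walk_edges_def)

lemma walk_edges_Cons2 [simp]:
  "walk_edges (x # y # p) = insert {x, y} (walk_edges (y # p))"
proof (intro set_eqI iffI)
  fix e assume "e \<in> walk_edges (x # y # p)"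
  then obtain i where "Suc i < length (x # y # p)"
    "e = {(x # y # p) ! i, (x # y # p) ! Suc i}"
    unfolding walk_edges_def by blast
  then show "e \<in> insert {x, y} (walk_edges (y # p))"
    by (cases i) (auto simp: walk_edges_def)
next
  fix e assume "e \<in> insert {x, y} (walk_edges (y # p))"
  then show "e \<in> walk_edges (x # y # p)"
    using walk_edges_nth[of 0 "x # y # p"] walk_edges_nth[of "Suc _" "x # y # p"]
    by (fastforce simp: walk_edges_def)
qed

lemma walk_edges_append_subset: "walk_edges p \<subseteq> walk_edges (p @ q)"
proof
  fix e assume "e \<in> walk_edges p"
  then obtain i where "Suc i < length p" "e = {p ! i, p ! Suc i}"
    unfolding walk_edges_def by blast
  then show "e \<in> walk_edges (p @ q)"
    using walk_edges_nth[of i "p @ q"] by (simp add: nth_append)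
qed

lemma walk_edges_snoc: "p \<noteq> [] \<Longrightarrow> walk_edges (p @ [z]) = insert {last p, z} (walk_edges p)"
  by (induction p rule: induct_list012) auto

text \<open>A path may not repeat a vertex, so if \<open>z\<close> already lies on the path to
  \<open>y\<close>, the path is cut off at \<open>z\<close>; otherwise \<open>z\<close> is
  appended.\<close>

lemma joined_snoc:
  assumes "joined V E x y" "(y, z) \<in> adj V E"
  shows "joined V E x z"
proof -
  obtain p where p: "is_path V E x p y"
    using assms(1) by (auto simp: joined_def)
  show ?thesis
  proof (cases "z \<in> set p")
    case True
    then obtain q q' where q: "p = (q @ [z]) @ q'"
      by (auto dest: split_list)
    then have "is_path V E x (q @ [z]) z"
      using p walk_edges_append_subset[of "q @ [z]" q']
      by (auto simp: is_path_def hd_append)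
    then show ?thesis
      by (auto simp: joined_def)
  next
    case False
    then have "is_path V E x (p @ [z]) z"
      using p assms(2) by (auto simp: is_path_def adj_def walk_edges_snoc)
    then show ?thesis
      by (auto simp: joined_def)
  qed
qed

text \<open>This replaces repetition-free paths by a closure, where concatenation is transitivity.
  The closure is reflexive even outside \<open>V\<close>, hence the conjunct
  \<open>x \<in> V\<close>.\<close>

lemma joined_iff_rtrancl: "joined V E x y \<longleftrightarrow> x \<in> V \<and> (x, y) \<in> (adj V E)\<^sup>*"
proof
  assume "joined V E x y"
  then obtain p where p: "is_path V E x p y"
    by (auto simp: joined_def)
  then have "x \<in> V"
    by (auto simp: is_path_def)
  moreover have "(x, y) \<in> (adj V E)\<^sup>*"
    using p
  proof (induction p arbitrary: x rule: induct_list012)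
    case 1
    then show ?case by (simp add: is_path_def)
  next
    case (2 a)
    then show ?case by (auto simp: is_path_def)
  next
    case (3 a b p)
    then have "is_path V E b (b # p) y" "(x, b) \<in> adj V E"
      by (auto simp: is_path_def adj_def)
    with 3 show ?case
      by (meson converse_rtrancl_into_rtrancl)
  qed
  ultimately show "x \<in> V \<and> (x, y) \<in> (adj V E)\<^sup>*" ..
next
  assume asm: "x \<in> V \<and> (x, y) \<in> (adj V E)\<^sup>*"
  then have "(x, y) \<in> (adj V E)\<^sup>*" by simp
  then show "joined V E x y"
  proof induction
    case base
    have "is_path V E x [x] x"
      using asm by (simp add: is_path_def)
    then show ?case by (auto simp: joined_def)
  next
    case (step y z)
    then show ?case by (blast intro: joined_snoc)
  qed
qed

lemma joined_mono: "joined V E x y \<Longrightarrow> E \<subseteq> E' \<Longrightarrow> joined V E' x y"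
  by (fastforce simp: joined_def is_path_def)

lemma joined_edge: "x \<in> V \<Longrightarrow> y \<in> V \<Longrightarrow> {x, y} \<in> E \<Longrightarrow> joined V E x y"
  by (auto simp: joined_iff_rtrancl adj_def)

lemma joined_two_edges:
  "\<lbrakk>x \<in> V; y \<in> V; z \<in> V; {x, y} \<in> E; {y, z} \<in> E\<rbrakk> \<Longrightarrow> joined V E x z"
  by (rule joined_snoc[OF joined_edge]) (auto simp: adj_def)

lemma walk_segment_rtrancl:
  assumes "i \<le> j" "j < length p"
    and "\<And>k. i \<le> k \<Longrightarrow> k < j \<Longrightarrow> (p ! k, p ! Suc k) \<in> R"
  shows "(p ! i, p ! j) \<in> R\<^sup>*"
  using assms
proof (induction j rule: dec_induct)
  case base
  then show ?case by simp
next
  case (step j)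
  then have "(p ! i, p ! j) \<in> R\<^sup>*" "(p ! j, p ! Suc j) \<in> R" by simp_all
  then show ?case by (rule rtrancl_into_rtrancl)
qed

section \<open>Removing an edge from a cycle\<close>

lemma cycle_edge_index_unique:
  assumes "distinct c" "length c \<ge> 3" "i < length c" "j < length c"
    and "{(c @ [hd c]) ! i, (c @ [hd c]) ! Suc i} = {(c @ [hd c]) ! j, (c @ [hd c]) ! Suc j}"
  shows "i = j"
proof -
  \<comment> \<open>Cyclic successor of an index: the last position wraps around to 0, matching the
    extra \<open>hd c\<close> at the end of the closed list.\<close>
  let ?s = "\<lambda>i. if Suc i < length c then Suc i else 0"
  have "hd c = c ! 0"
    using assms(2) by (intro hd_conv_nth) auto
  then have nth: "(c @ [hd c]) ! k = c ! k" "(c @ [hd c]) ! Suc k = c ! ?s k"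
    if "k < length c" for k
    using that by (auto simp: nth_append Suc_lessI)
  have s: "?s k < length c" for k
    using assms(2) by auto
  have inj: "c ! a = c ! b \<longleftrightarrow> a = b" if "a < length c" "b < length c" for a b
    using assms(1) that by (simp add: nth_eq_iff_index_eq)
  \<comment> \<open>Equal two-element sets leave only equal indices or indices that are cyclic
    successors of each other; the latter would force a cycle of length at most 2.\<close>
  have "i = j \<or> i = ?s j \<and> ?s i = j"
    using assms(5) unfolding nth[OF assms(3)] nth[OF assms(4)] doubleton_eq_iff
    using inj[OF assms(3,4)] inj[OF assms(3) s] inj[OF s assms(4)] by blast
  then show ?thesis
    using assms(2) by (auto split: if_splits)
qed

text \<open>The rest of the cycle is a way around \<open>e\<close>. This is what turns an edge that
  is alone in its colour on a cycle into two vertices joined in both colours.\<close>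

lemma joined_around_cycle:
  assumes c: "is_cycle E c" and V: "\<Union>E \<subseteq> V" and e: "e \<in> cycle_edges c"
  obtains x y where "e = {x, y}" "x \<noteq> y" "x \<in> V" "y \<in> V" "joined V (cycle_edges c - {e}) x y"
proof -
  let ?p = "c @ [hd c]" and ?R = "adj V (cycle_edges c - {e})"
  have d: "distinct c" "length c \<ge> 3" and sub: "cycle_edges c \<subseteq> E"
    using c by (auto simp: is_cycle_def)
  have hd: "hd c = c ! 0"
    using d(2) by (intro hd_conv_nth) auto
  obtain i where i: "i < length c" "e = {?p ! i, ?p ! Suc i}"
    using e by (auto simp: cycle_edges_def walk_edges_def)
  have R: "(?p ! k, ?p ! Suc k) \<in> ?R" if "k < length c" "k \<noteq> i" for k
  proof -
    have "{?p ! k, ?p ! Suc k} \<in> cycle_edges c"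
      unfolding cycle_edges_def using that by (intro walk_edges_nth) simp
    moreover have "{?p ! k, ?p ! Suc k} \<noteq> e"
      using cycle_edge_index_unique[OF d that(1) i(1)] that i(2) by blast
    ultimately show ?thesis
      using sub V unfolding adj_def by blast
  qed
  \<comment> \<open>The way around consists of two arcs, from position \<open>Suc i\<close> to the
    end and from the start to position \<open>i\<close>; they fit together because the closed list
    ends where it starts.\<close>
  have "(?p ! Suc i, ?p ! length c) \<in> ?R\<^sup>*"
    using i(1) by (intro walk_segment_rtrancl R) auto
  moreover have "(?p ! 0, ?p ! i) \<in> ?R\<^sup>*"
    using i(1) by (intro walk_segment_rtrancl R) auto
  moreover have "?p ! length c = ?p ! 0"
    using d(2) hd by (auto simp: nth_append)
  ultimately have "(?p ! Suc i, ?p ! i) \<in> ?R\<^sup>*"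
    by (metis rtrancl_trans)
  moreover have mem: "?p ! Suc i \<in> V" "?p ! i \<in> V"
    using e sub V i(2) by blast+
  moreover have "?p ! Suc i \<noteq> ?p ! i"
  proof (cases "Suc i < length c")
    case True
    then show ?thesis using d by (simp add: nth_append nth_eq_iff_index_eq)
  next
    case False
    then have "Suc i = length c" "i \<noteq> 0" using i(1) d(2) by auto
    then have "?p ! Suc i = c ! 0" "?p ! i = c ! i"
      using i(1) hd by (auto simp: nth_append)
    moreover have "c \<noteq> []" using i(1) by auto
    ultimately show ?thesis
      using \<open>i \<noteq> 0\<close> nth_eq_iff_index_eq[OF d(1) _ i(1), of 0] by simp
  qed
  ultimately show ?thesis
    using that[of "?p ! Suc i" "?p ! i"] i(2) by (simp add: joined_iff_rtrancl insert_commute)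
qed

section \<open>4-cycles and ribbons\<close>

lemma four_cycle_iff:
  "four_cycle E a b c d \<longleftrightarrow>
     distinct [a, b, c, d] \<and> {a, b} \<in> E \<and> {b, c} \<in> E \<and> {c, d} \<in> E \<and> {d, a} \<in> E"
  by (auto simp: four_cycle_def is_cycle_def cycle_edges_def)

lemma four_cycle_rotate: "four_cycle E a b c d \<Longrightarrow> four_cycle E b c d a"
  by (auto simp: four_cycle_iff)

lemma four_cycle_opposite: "four_cycle E a b c d \<Longrightarrow> ({a, b}, {c, d}) \<in> opposite E"
  by (auto simp: opposite_def)

text \<open>Symmetry holds because rotating a 4-cycle twice swaps its two opposite edges. The
  closure is reflexive on all sets, so it is an equivalence on \<open>UNIV\<close> and not just on
  \<open>E\<close>.\<close>

lemma equiv_ribbon: "equiv UNIV ((opposite E)\<^sup>*)"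
proof -
  have "sym (opposite E)"
    unfolding sym_def opposite_def by (blast dest: four_cycle_rotate)
  then show ?thesis
    by (simp add: equiv_def refl_rtrancl sym_rtrancl trans_rtrancl)
qed

lemma ribbon_closed:
  assumes "r \<in> ribbons E" "e \<in> r" "(e, f) \<in> (opposite E)\<^sup>*"
  shows "f \<in> r"
proof -
  obtain e0 where "r = (opposite E)\<^sup>* `` {e0}"
    using assms(1) by (auto simp: ribbons_def elim!: quotientE)
  then show ?thesis
    using assms(2,3) by (auto intro: rtrancl_trans)
qed

lemma ribbons_disjoint:
  assumes "r \<in> ribbons E" "s \<in> ribbons E" "e \<in> r" "e \<in> s"
  shows "r = s"
proof -
  have q: "ribbons E \<subseteq> UNIV // (opposite E)\<^sup>*"
    by (auto simp: ribbons_def quotient_def)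
  then show ?thesis
    using quotient_disj[OF equiv_ribbon, of r E s] assms by blast
qed

lemma ribbon_subset:
  assumes "r \<in> ribbons E" shows "r \<subseteq> E"
proof
  fix f assume "f \<in> r"
  with assms obtain e where "e \<in> E" "(e, f) \<in> (opposite E)\<^sup>*"
    by (auto simp: ribbons_def elim!: quotientE)
  from this(2,1) show "f \<in> E"
    by induction (auto simp: opposite_def four_cycle_iff)
qed

lemma ribbon_through:
  assumes "e \<in> E" obtains r where "r \<in> ribbons E" "e \<in> r"
  using assms by (auto simp: ribbons_def intro: quotientI that)

lemma ribbon_nonempty: "r \<in> ribbons E \<Longrightarrow> r \<noteq> {}"
  by (auto simp: ribbons_def elim!: quotientE)

text \<open>Hence a brace that is a diagonal of two different 4-cycles lies in a single ribbon.\<close>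

lemma K23_ribbon:
  assumes r: "r \<in> ribbons E" and ab: "{a, b} \<in> r"
    and abcd: "four_cycle E a b c d" and v: "{a, v} \<in> E" "{v, c} \<in> E" "distinct [a, b, c, d, v]"
  shows "{a, v} \<in> r" "{c, v} \<in> r"
proof -
  \<comment> \<open>These are 4-cycles of the complete bipartite graph with parts
    \<open>a, c\<close> and \<open>b, d, v\<close>. Their opposite pairs form the chain
    \<open>ab\<close>, \<open>cv\<close>, \<open>ad\<close>, \<open>cb\<close>,
    \<open>av\<close>.\<close>
  have "four_cycle E a b c v" "four_cycle E c v a d" "four_cycle E a d c b" "four_cycle E c b a v"
    using abcd v by (auto simp: four_cycle_iff insert_commute)
  note opp = this[THEN four_cycle_opposite]
  show cv: "{c, v} \<in> r"
    using ribbon_closed[OF r ab] opp(1) by blast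
  have "{a, d} \<in> r"
    using ribbon_closed[OF r cv] opp(2) by blast
  then have "{c, b} \<in> r"
    using ribbon_closed[OF r] opp(3) by blast
  then show "{a, v} \<in> r"
    using ribbon_closed[OF r] opp(4) by blast
qed

section \<open>Ribbons of the braced graph\<close>

lemma brace_ribbon_superset: "e \<in> r \<Longrightarrow> e \<in> brace_ribbon Ec Ed r"
  by (simp add: brace_ribbon_def)

text \<open>A brace is an unordered pair, so the 4-cycle behind it may start at either end. A
  rotation by two lets it start at the prescribed \<open>x\<close>, so that 4-cycles from two
  ribbons can be compared.\<close>

lemma brace_ribbon_brace:
  assumes "{x, y} \<in> brace_ribbon Ec Ed r - Ec" "r \<subseteq> Ec"
  obtains u v where "four_cycle Ec x u y v" "{x, u} \<in> r" "{y, v} \<in> r"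
proof -
  obtain a b u v where *: "{x, y} = {a, b}" "{a, b} \<in> Ed" "four_cycle Ec a u b v"
      "{a, u} \<in> r" "{b, v} \<in> r"
    using assms by (auto simp: brace_ribbon_def)
  from *(1) consider "x = a" "y = b" | "x = b" "y = a"
    by (auto simp: doubleton_eq_iff)
  then show ?thesis
  proof cases
    case 1
    with * that show ?thesis by blast
  next
    case 2
    moreover from *(3) have "four_cycle Ec b v a u"
      by (blast dest: four_cycle_rotate)
    ultimately show ?thesis
      using * that[of v u] by (simp add: insert_commute)
  qed
qed

text \<open>Ribbons of the unbraced graph are disjoint, so distinct braced ribbons can share only
  braces. A shared brace is a diagonal of a 4-cycle for each ribbon, and comparing the two 4-cycles
  either gives a common unbraced edge or shows that the ribbons cross in one 4-cycle.\<close>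

lemma braced_ribbons_meet:
  assumes disj: "Ec \<inter> Ed = {}"
    and r': "r' \<in> braced_ribbons Ec Ed" and s': "s' \<in> braced_ribbons Ec Ed"
    and e: "e \<in> r'" "e \<in> s'"
  shows "r' = s' \<or> {r', s'} \<in> bracing_edges Ec Ed"
proof -
  obtain r s where r: "r \<in> ribbons Ec" "r' = brace_ribbon Ec Ed r"
    and s: "s \<in> ribbons Ec" "s' = brace_ribbon Ec Ed s"
    using r' s' by (auto simp: braced_ribbons_def)
  note sub = ribbon_subset[OF r(1)] ribbon_subset[OF s(1)]
  show ?thesis
  proof (cases "e \<in> Ec")
    case True
    then have "e \<in> r" "e \<in> s"
      using e disj r s by (auto simp: brace_ribbon_def)
    then show ?thesis
      using ribbons_disjoint[OF r(1) s(1)] r(2) s(2) by blast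
  next
    case False
    then obtain x y where xy: "e = {x, y}"
      using e(1) r(2) sub by (auto simp: brace_ribbon_def)
    have "{x, y} \<in> brace_ribbon Ec Ed r - Ec" "{x, y} \<in> brace_ribbon Ec Ed s - Ec"
      using e r(2) s(2) False xy by auto
    note brace = brace_ribbon_brace[OF this(1) sub(1)] brace_ribbon_brace[OF this(2) sub(2)]
    obtain u v where u: "four_cycle Ec x u y v" "{x, u} \<in> r" "{y, v} \<in> r"
      by (rule brace(1))
    obtain w z where w: "four_cycle Ec x w y z" "{x, w} \<in> s" "{y, z} \<in> s"
      by (rule brace(2))
    have eq: "r' = s'" if "f \<in> r" "f \<in> s" for f
      using ribbons_disjoint[OF r(1) s(1) that] r(2) s(2) by simp
    have "w \<noteq> z"
      using w(1) by (simp add: four_cycle_iff)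
    \<comment> \<open>Either the second 4-cycle has a middle vertex outside the first, or both have
      the same middle vertices, in the same or in exchanged order. Only the exchanged order allows
      different ribbons.\<close>
    then consider "w \<noteq> u" "w \<noteq> v" | "z \<noteq> u" "z \<noteq> v" | "w = u" | "w = v" "z = u"
      by blast
    then show ?thesis
    proof cases
      case 1
      then have "{x, w} \<in> r"
        using u(1) w(1) by (intro K23_ribbon[OF r(1) u(2,1)]) (auto simp: four_cycle_iff)
      then show ?thesis using eq w(2) by blast
    next
      case 2
      then have "{y, z} \<in> r"
        using u(1) w(1)
        by (intro K23_ribbon[OF r(1) u(2,1)]) (auto simp: four_cycle_iff insert_commute)
      then show ?thesis using eq w(3) by blast
    next
      case 3
      then show ?thesis using eq u(2) w(2) by blast
    next
      case 4
      \<comment> \<open>One pair of opposite sides of this 4-cycle lies in \<open>r'\<close> and the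
        other in \<open>s'\<close>, which is adjacency in the ribbon graph once the ribbons
        differ.\<close>
      have "four_cycle (Ec \<union> Ed) x u y v"
        using u(1) by (auto simp: four_cycle_iff)
      moreover have "{x, u} \<in> r'" "{y, v} \<in> r'"
        unfolding r(2) using u(2,3) by (blast intro: brace_ribbon_superset)+
      moreover have "{x, v} \<in> s'" "{y, u} \<in> s'"
        unfolding s(2) using w(2,3)[unfolded 4] by (blast intro: brace_ribbon_superset)+
      then have "{x, v} \<in> s'" "{u, y} \<in> s'"
        by (auto simp: insert_commute[of u y])
      ultimately have meet: "\<exists>u1 u2 u3 u4. four_cycle (Ec \<union> Ed) u1 u2 u3 u4 \<and>
           {u1, u2} \<in> r' \<and> {u3, u4} \<in> r' \<and> {u1, u4} \<in> s' \<and> {u2, u3} \<in> s'"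
        by (intro exI[of _ x] exI[of _ u] exI[of _ y] exI[of _ v] conjI)
      have "{r', s'} \<in> ribbon_graph_edges Ec Ed" if "r' \<noteq> s'"
        unfolding ribbon_graph_edges_def mem_Collect_eq
        by (intro exI[of _ r'] exI[of _ s'] conjI refl r' s' that meet)
      then show ?thesis
        using e unfolding bracing_edges_def by blast
    qed
  qed
qed

text \<open>A brace belongs to the ribbon of any side of a 4-cycle of which it is a diagonal, since
  that ribbon also contains the opposite side.\<close>

lemma braced_ribbon_through:
  assumes "\<forall>e\<in>Ed. \<exists>a b c d. four_cycle Ec a b c d \<and> e = {a, c}" "e \<in> Ec \<union> Ed"
  obtains r where "r \<in> braced_ribbons Ec Ed" "e \<in> r"
proof (cases "e \<in> Ec")
  case True
  then obtain r where "r \<in> ribbons Ec" "e \<in> r"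
    by (rule ribbon_through)
  then show ?thesis
    using that[of "brace_ribbon Ec Ed r"] by (auto simp: braced_ribbons_def brace_ribbon_def)
next
  case False
  then have e: "e \<in> Ed"
    using assms(2) by simp
  from bspec[OF assms(1) e] obtain a b c d where *: "four_cycle Ec a b c d" "e = {a, c}"
    by (elim exE conjE)
  then have "{a, b} \<in> Ec"
    by (simp add: four_cycle_iff)
  then obtain r where r: "r \<in> ribbons Ec" "{a, b} \<in> r"
    by (rule ribbon_through)
  then have "{c, d} \<in> r"
    using ribbon_closed[OF r] four_cycle_opposite[OF *(1)] by blast
  then have "e \<in> brace_ribbon Ec Ed r"
    using e * r unfolding brace_ribbon_def by blast
  then show ?thesis
    using that r by (auto simp: braced_ribbons_def)
qed

lemma braced_ribbon_subset: "r \<in> braced_ribbons Ec Ed \<Longrightarrow> r \<subseteq> Ec \<union> Ed"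
  using ribbon_subset by (fastforce simp: braced_ribbons_def brace_ribbon_def)

lemma braced_ribbon_nonempty: "r \<in> braced_ribbons Ec Ed \<Longrightarrow> r \<noteq> {}"
  using ribbon_nonempty by (fastforce simp: braced_ribbons_def brace_ribbon_def)

section \<open>NAC-colourings and their cartesian condition\<close>

lemma colour_neq_iff: "(a :: colour) \<noteq> b \<Longrightarrow> c \<noteq> a \<longleftrightarrow> c = b"
  by (cases a; cases b; cases c) auto

lemma cartesian_NAC_no_bichromatic_pair:
  assumes "cartesian_NAC_colouring V E \<delta>" "x \<in> V" "y \<in> V" "x \<noteq> y" "k \<noteq> l"
    and "joined V (colour_class E \<delta> k) x y" "joined V (colour_class E \<delta> l) x y"
  shows False
  using assms unfolding cartesian_NAC_colouring_def by (cases k; cases l) auto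

text \<open>The condition on cycles follows from the cartesian one: an edge alone in its colour on a
  cycle joins its ends in that colour, while the rest of the cycle joins them in the other.\<close>

lemma not_joined_both_imp_NAC:
  assumes V: "\<Union>E \<subseteq> V" and surj: "\<delta> ` E = {Red, Blue}"
    and no: "\<And>x y k l. \<lbrakk>x \<in> V; y \<in> V; x \<noteq> y; k \<noteq> l; joined V (colour_class E \<delta> k) x y;
               joined V (colour_class E \<delta> l) x y\<rbrakk> \<Longrightarrow> False"
  shows "cartesian_NAC_colouring V E \<delta>"
proof -
  have "(\<exists>k. \<forall>e\<in>cycle_edges c. \<delta> e = k) \<or> (\<forall>k. card {e \<in> cycle_edges c. \<delta> e = k} \<ge> 2)"
    if c: "is_cycle E c" for c
  proof (rule ccontr)
    assume contr: "\<not> ?thesis"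
    then obtain k where k: "\<not> card {e \<in> cycle_edges c. \<delta> e = k} \<ge> 2" by blast
    obtain l where l: "k \<noteq> l"
      using colour.distinct(1) by metis
    have "finite (cycle_edges c)"
      by (auto simp: cycle_edges_def walk_edges_def)
    \<comment> \<open>Without an edge of colour \<open>k\<close> the cycle would be monochromatic in
      \<open>l\<close>; so colour \<open>k\<close> occurs, and hence exactly once.\<close>
    moreover have "{e \<in> cycle_edges c. \<delta> e = k} \<noteq> {}"
      using contr colour_neq_iff[OF l] by blast
    ultimately have "card {e \<in> cycle_edges c. \<delta> e = k} > 0"
      by (simp only: card_gt_0_iff) simp
    then have "card {e \<in> cycle_edges c. \<delta> e = k} = 1"
      using k by linarith
    then obtain e where e: "{e \<in> cycle_edges c. \<delta> e = k} = {e}"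
      by (auto simp: card_1_singleton_iff)
    have sub: "cycle_edges c \<subseteq> E"
      using c by (simp add: is_cycle_def)
    have "e \<in> cycle_edges c" using e by blast
    then obtain x y where xy: "e = {x, y}" "x \<noteq> y" "x \<in> V" "y \<in> V"
      "joined V (cycle_edges c - {e}) x y"
      by (rule joined_around_cycle[OF c V])
    have "cycle_edges c - {e} \<subseteq> colour_class E \<delta> l"
      using e sub colour_neq_iff[OF l] by (auto simp: colour_class_def)
    with xy(5) have "joined V (colour_class E \<delta> l) x y"
      by (rule joined_mono)
    moreover have "joined V (colour_class E \<delta> k) x y"
      using xy e sub by (intro joined_edge) (auto simp: colour_class_def)
    ultimately show False
      using no xy l by blast
  qed
  then show ?thesis
    using surj no[where k = Red and l = Blue]
    unfolding cartesian_NAC_colouring_def NAC_colouring_def by auto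
qed

text \<open>Two edges of each colour would need four edges, and a triangle has at most
  three.\<close>

lemma NAC_triangle:
  assumes "NAC_colouring E \<delta>" "distinct [a, b, c]" "{a, b} \<in> E" "{b, c} \<in> E" "{a, c} \<in> E"
  shows "\<delta> {a, b} = \<delta> {a, c}"
proof -
  let ?C = "{{a, b}, {b, c}, {a, c}}"
  have C: "cycle_edges [a, b, c] = ?C"
    by (auto simp: cycle_edges_def insert_commute)
  moreover have "is_cycle E [a, b, c]"
    using assms C unfolding is_cycle_def by simp
  moreover have False if two: "\<forall>k. card {e \<in> ?C. \<delta> e = k} \<ge> 2"
  proof -
    have "card ({e \<in> ?C. \<delta> e = Red} \<union> {e \<in> ?C. \<delta> e = Blue}) =
        card {e \<in> ?C. \<delta> e = Red} + card {e \<in> ?C. \<delta> e = Blue}"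
      by (rule card_Un_disjoint) auto
    moreover have "card ({e \<in> ?C. \<delta> e = Red} \<union> {e \<in> ?C. \<delta> e = Blue}) \<le> card ?C"
      by (rule card_mono) auto
    moreover have "card ?C \<le> 3"
      by (simp add: card_insert_if)
    ultimately show False
      using two[rule_format, of Red] two[rule_format, of Blue] by linarith
  qed
  ultimately have "\<exists>k. \<forall>e\<in>?C. \<delta> e = k"
    using assms(1) unfolding NAC_colouring_def by metis
  then show ?thesis
    by auto
qed

text \<open>Suppose the two edges differ in colour. If the other two sides agree, some side is alone
  in its colour; if they differ, the cycle splits into two monochromatic paths of length two with
  common ends.\<close>

lemma cartesian_NAC_opposite:
  assumes V: "\<Union>E \<subseteq> V" and cart: "cartesian_NAC_colouring V E \<delta>"
    and cyc: "four_cycle E a b c d"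
  shows "\<delta> {a, b} = \<delta> {c, d}"
proof (rule ccontr)
  assume neq: "\<delta> {a, b} \<noteq> \<delta> {c, d}"
  let ?k = "\<delta> {a, b}" and ?l = "\<delta> {c, d}"
  let ?C = "{{a, b}, {b, c}, {c, d}, {d, a}}"
  have E: "{a, b} \<in> E" "{b, c} \<in> E" "{c, d} \<in> E" "{d, a} \<in> E" and dist: "distinct [a, b, c, d]"
    using cyc by (auto simp: four_cycle_iff)
  have inV: "a \<in> V" "b \<in> V" "c \<in> V" "d \<in> V"
    using E V by blast+
  have C: "cycle_edges [a, b, c, d] = ?C"
    by (auto simp: cycle_edges_def)
  have "(\<exists>m. \<forall>e\<in>?C. \<delta> e = m) \<or> (\<forall>k. card {e \<in> ?C. \<delta> e = k} \<ge> 2)"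
    using cart cyc
    unfolding cartesian_NAC_colouring_def NAC_colouring_def four_cycle_def C[symmetric] by blast
  moreover have "\<not> (\<exists>m. \<forall>e\<in>?C. \<delta> e = m)"
    using neq by auto
  ultimately have two: "card {e \<in> ?C. \<delta> e = k} \<ge> 2" for k
    by blast
  have "\<delta> {b, c} = ?k \<or> \<delta> {b, c} = ?l" "\<delta> {d, a} = ?k \<or> \<delta> {d, a} = ?l"
    using colour_neq_iff[OF neq] by blast+
  then consider "\<delta> {b, c} = ?k" "\<delta> {d, a} = ?k" | "\<delta> {b, c} = ?l" "\<delta> {d, a} = ?l"
    | "\<delta> {b, c} = ?k" "\<delta> {d, a} = ?l" | "\<delta> {b, c} = ?l" "\<delta> {d, a} = ?k"
    by blast
  then show False
  proof cases
    case 1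
    then have "{e \<in> ?C. \<delta> e = ?l} \<subseteq> {{c, d}}" using neq by auto
    then have "card {e \<in> ?C. \<delta> e = ?l} \<le> card {{c, d}}"
      by (rule card_mono[rotated]) simp
    with two[of ?l] have "2 \<le> card {{c, d}}" by (rule le_trans)
    then show False by simp
  next
    case 2
    then have "{e \<in> ?C. \<delta> e = ?k} \<subseteq> {{a, b}}" using neq by auto
    then have "card {e \<in> ?C. \<delta> e = ?k} \<le> card {{a, b}}"
      by (rule card_mono[rotated]) simp
    with two[of ?k] have "2 \<le> card {{a, b}}" by (rule le_trans)
    then show False by simp
  next
    case 3
    have "joined V (colour_class E \<delta> ?k) a c"
      by (rule joined_two_edges[of _ _ b]) (use inV E 3 in \<open>auto simp: colour_class_def\<close>)
    moreover have "joined V (colour_class E \<delta> ?l) a c"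
      by (rule joined_two_edges[of _ _ d])
        (use inV E 3 in \<open>auto simp: colour_class_def insert_commute\<close>)
    ultimately show False
      using cartesian_NAC_no_bichromatic_pair[OF cart _ _ _ neq] inV dist by auto
  next
    case 4
    have "joined V (colour_class E \<delta> ?k) b d"
      by (rule joined_two_edges[of _ _ a])
        (use inV E 4 in \<open>auto simp: colour_class_def insert_commute\<close>)
    moreover have "joined V (colour_class E \<delta> ?l) b d"
      by (rule joined_two_edges[of _ _ c]) (use inV E 4 in \<open>auto simp: colour_class_def\<close>)
    ultimately show False
      using cartesian_NAC_no_bichromatic_pair[OF cart _ _ _ neq] inV dist by auto
  qed
qed

lemma cartesian_NAC_braced_ribbon_mono:
  assumes V: "\<Union>(Ec \<union> Ed) \<subseteq> V" and cart: "cartesian_NAC_colouring V (Ec \<union> Ed) \<delta>"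
    and r': "r' \<in> braced_ribbons Ec Ed" and ef: "e \<in> r'" "f \<in> r'"
  shows "\<delta> e = \<delta> f"
proof -
  obtain r where r: "r \<in> ribbons Ec" "r' = brace_ribbon Ec Ed r"
    using r' by (auto simp: braced_ribbons_def)
  obtain g where g: "r = (opposite Ec)\<^sup>* `` {g}"
    using r(1) by (auto simp: ribbons_def elim!: quotientE)
  \<comment> \<open>All edges are compared with the generator \<open>g\<close> of the class, so that
    the induction runs along a chain of opposite edges starting at \<open>g\<close>.\<close>
  have unbraced: "\<delta> h = \<delta> g" if "h \<in> r" for h
  proof -
    from that g have "(g, h) \<in> (opposite Ec)\<^sup>*" by simp
    then show ?thesis
    proof induction
      case base
      show ?case ..
    next
      case (step h h')
      then obtain a b c d where "h = {a, b}" "h' = {c, d}" "four_cycle (Ec \<union> Ed) a b c d"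
        by (auto simp: opposite_def four_cycle_iff)
      with cartesian_NAC_opposite[OF V cart] step.IH show ?case by metis
    qed
  qed
  have "\<delta> h = \<delta> g" if "h \<in> r'" for h
  proof (cases "h \<in> r")
    case False
    then obtain a b c d where "h = {a, c}" "{a, c} \<in> Ed" "four_cycle Ec a b c d" "{a, b} \<in> r"
      using \<open>h \<in> r'\<close> r(2) by (auto simp: brace_ribbon_def)
    \<comment> \<open>The brace closes a triangle with the sides \<open>{a, b}\<close> and
      \<open>{b, c}\<close>.\<close>
    moreover from this have "\<delta> {a, b} = \<delta> {a, c}"
      using cart by (intro NAC_triangle[of "Ec \<union> Ed"])
        (auto simp: cartesian_NAC_colouring_def four_cycle_iff)
    ultimately show ?thesis using unbraced by metis
  qed (rule unbraced)
  with ef show ?thesis by metis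
qed

theorem theorem4p5:
  fixes V :: "'a set" and Ec Ed :: "'a set set"
  assumes "braced_ribbon_cutting V Ec Ed"
    and "\<forall>x\<in>V. \<forall>y\<in>V. x \<noteq> y \<longrightarrow> (\<exists>r\<in>braced_ribbons Ec Ed. separates V Ec Ed r x y)"
  shows "connected_graph (braced_ribbons Ec Ed) (bracing_edges Ec Ed) \<longleftrightarrow>
           \<not> (\<exists>\<delta>. cartesian_NAC_colouring V (Ec \<union> Ed) \<delta>)"
proof -
  let ?B = "braced_ribbons Ec Ed" and ?F = "bracing_edges Ec Ed"
  have disj: "Ec \<inter> Ed = {}" and ne: "Ec \<noteq> {}" and simple: "simple_graph V Ec"
    and brace: "\<forall>e\<in>Ed. \<exists>a b c d. four_cycle Ec a b c d \<and> e = {a, c}"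
    using assms(1) by (auto simp: braced_ribbon_cutting_def ribbon_cutting_def)
  have "\<Union>Ec \<subseteq> V"
    using simple by (auto simp: simple_graph_def)
  \<comment> \<open>Braces add no vertices: their ends are ends of unbraced edges.\<close>
  moreover have "e \<subseteq> \<Union>Ec" if "e \<in> Ed" for e
  proof -
    from bspec[OF brace that] obtain a b c d where "four_cycle Ec a b c d" "e = {a, c}"
      by (elim exE conjE)
    then have "{a, b} \<in> Ec" "{b, c} \<in> Ec" "e = {a, c}"
      by (simp_all add: four_cycle_iff)
    then show ?thesis by blast
  qed
  ultimately have V: "\<Union>(Ec \<union> Ed) \<subseteq> V" by blast
  show ?thesis
  proof
    assume conn: "connected_graph ?B ?F"
    show "\<not> (\<exists>\<delta>. cartesian_NAC_colouring V (Ec \<union> Ed) \<delta>)"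
    proof
      assume "\<exists>\<delta>. cartesian_NAC_colouring V (Ec \<union> Ed) \<delta>"
      then obtain \<delta> where cart: "cartesian_NAC_colouring V (Ec \<union> Ed) \<delta>" ..
      note mono = cartesian_NAC_braced_ribbon_mono[OF V cart]
      have same: "\<delta> e = \<delta> f" if ef: "e \<in> Ec \<union> Ed" "f \<in> Ec \<union> Ed" for e f
      proof -
        obtain r where r: "r \<in> ?B" "e \<in> r"
          by (rule braced_ribbon_through[OF brace ef(1)])
        obtain s where s: "s \<in> ?B" "f \<in> s"
          by (rule braced_ribbon_through[OF brace ef(2)])
        from r s have "(r, s) \<in> (adj ?B ?F)\<^sup>*"
          using conn by (auto simp: connected_graph_def joined_iff_rtrancl)
        \<comment> \<open>Along a walk in the bracing graph, consecutive ribbons share an edge,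
          which carries the colour of one monochromatic ribbon over to the next.\<close>
        then have "\<forall>h\<in>s. \<delta> e = \<delta> h"
        proof induction
          case base
          show ?case using mono[OF r] by blast
        next
          case (step t t')
          then obtain h where "h \<in> t" "h \<in> t'" "t' \<in> ?B"
            by (auto simp: adj_def bracing_edges_def doubleton_eq_iff)
          then show ?case using step.IH mono[of t' h] by metis
        qed
        then show ?thesis using s by blast
      qed
      have "\<delta> ` (Ec \<union> Ed) = {Red, Blue}"
        using cart by (simp add: cartesian_NAC_colouring_def NAC_colouring_def)
      then have "Red \<in> \<delta> ` (Ec \<union> Ed)" "Blue \<in> \<delta> ` (Ec \<union> Ed)" by auto
      then show False using same by (metis colour.distinct(1) imageE)
    qed
  next
    assume none: "\<not> (\<exists>\<delta>. cartesian_NAC_colouring V (Ec \<union> Ed) \<delta>)"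
    show "connected_graph ?B ?F"
    proof (rule ccontr)
      assume "\<not> connected_graph ?B ?F"
      moreover have "?B \<noteq> {}"
        using ne braced_ribbon_through[OF brace] by blast
      ultimately obtain r s where r: "r \<in> ?B" and s: "s \<in> ?B" and rs: "\<not> joined ?B ?F r s"
        by (auto simp: connected_graph_def)
      \<comment> \<open>Red is the component of \<open>r\<close> in the bracing graph, blue is
        everything else. The existential is there because a brace may lie in more than one
        ribbon.\<close>
      define \<delta> where "\<delta> e = (if \<exists>t\<in>?B. joined ?B ?F r t \<and> e \<in> t then Red else Blue)" for e
      \<comment> \<open>Any ribbon through \<open>e\<close> decides its colour: two ribbons through
        \<open>e\<close> are equal or adjacent in the bracing graph, hence in the same
        component.\<close>
      have \<delta>: "\<delta> e = Red \<longleftrightarrow> joined ?B ?F r t" if t: "t \<in> ?B" "e \<in> t" for e t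
      proof
        assume "\<delta> e = Red"
        then obtain t' where "t' \<in> ?B" "joined ?B ?F r t'" "e \<in> t'"
          by (auto simp: \<delta>_def split: if_splits)
        moreover from this t have "t' = t \<or> (t', t) \<in> adj ?B ?F"
          using braced_ribbons_meet[OF disj, of t' t e] by (auto simp: adj_def)
        ultimately show "joined ?B ?F r t"
          using joined_snoc by metis
      qed (use t in \<open>auto simp: \<delta>_def\<close>)
      have "joined ?B ?F r r"
        using r by (simp add: joined_iff_rtrancl)
      then have "\<exists>e\<in>Ec \<union> Ed. \<delta> e = Red"
        using \<delta>[OF r] braced_ribbon_nonempty[OF r] braced_ribbon_subset[OF r] by blast
      moreover have "\<exists>e\<in>Ec \<union> Ed. \<delta> e \<noteq> Red"
        using \<delta>[OF s] rs braced_ribbon_nonempty[OF s] braced_ribbon_subset[OF s] by blast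
      ultimately obtain e f where "e \<in> Ec \<union> Ed" "\<delta> e = Red" "f \<in> Ec \<union> Ed" "\<delta> f \<noteq> Red"
        by metis
      then have "Red \<in> \<delta> ` (Ec \<union> Ed)" "Blue \<in> \<delta> ` (Ec \<union> Ed)"
        using colour_neq_iff[of Red Blue "\<delta> f"] image_eqI[of Red \<delta> e] image_eqI[of Blue \<delta> f]
        by simp_all
      moreover have "\<delta> ` (Ec \<union> Ed) \<subseteq> {Red, Blue}"
        using colour_neq_iff[of Red Blue] by auto
      ultimately have surj: "\<delta> ` (Ec \<union> Ed) = {Red, Blue}"
        by blast
      have "cartesian_NAC_colouring V (Ec \<union> Ed) \<delta>"
      proof (rule not_joined_both_imp_NAC[OF V surj])
        fix x y k l
        assume xy: "x \<in> V" "y \<in> V" "x \<noteq> y" and kl: "k \<noteq> l"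
          and j: "joined V (colour_class (Ec \<union> Ed) \<delta> k) x y"
            "joined V (colour_class (Ec \<union> Ed) \<delta> l) x y"
        obtain t where t: "t \<in> ?B" "\<not> joined V (Ec \<union> Ed - t) x y"
          using assms(2) xy unfolding separates_def by blast
        \<comment> \<open>The separating ribbon \<open>t\<close> is monochromatic and so misses some
          colour \<open>m\<close>. As \<open>k\<close> and \<open>l\<close> are all the colours,
          \<open>x\<close> and \<open>y\<close> are joined in colour \<open>m\<close>, that is,
          without using \<open>t\<close>.\<close>
        have "(\<forall>e\<in>t. \<delta> e \<noteq> Red) \<or> (\<forall>e\<in>t. \<delta> e \<noteq> Blue)"
          using \<delta>[OF t(1)] by (cases "joined ?B ?F r t") auto
        then obtain m where m: "\<forall>e\<in>t. \<delta> e \<noteq> m" by blast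
        then have "colour_class (Ec \<union> Ed) \<delta> m \<subseteq> Ec \<union> Ed - t"
          by (auto simp: colour_class_def)
        moreover have "joined V (colour_class (Ec \<union> Ed) \<delta> m) x y"
          using j colour_neq_iff[OF kl, of m] by metis
        ultimately show False
          using t(2) joined_mono by metis
      qed
      with none show False by blast
    qed
  qed
qed

end
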